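(* Let $n\ge 8$ be an even integer and let $\mathfrak S_{(n,5)}$ be the numerical semigroup generated by $m_0=n^2+3n+1$, $m_1=n^2+3n+2$, $m_2=n^2+3n+3$, $m_3=n^2+4n+3$, $m_4=n^2+4n+4$. Then the Apéry table $\mathrm{AT}(\mathfrak S_{(n,5)},m_0)$ is an $(n+1)\times m_0$ matrix of the form $\begin{pmatrix}\mathcal B_1&\cdots&\mathcal B_{11}\end{pmatrix}$ (for the ordering of the Apéry set given by the first row of this matrix), where, with row index $1\le i\le n+1$ and column index $j$ starting at $1$: $\bullet$ $\mathcal B_1=(b^{(1)}_{ij})_{(n+1)\times 2}$ with $b^{(1)}_{i1}=(i-1)m_0$ for $1\le i\le n+1$; $b^{(1)}_{i2}=m_1$ for $i=1,2$; $b^{(1)}_{i2}=m_1+(i-2)m_0$ for $3\le i\le n+1$. $\bullet$ $\mathcal B_2=(b^{(2)}_{ij})_{(n+1)\times\frac n2}$, $b^{(2)}_{ij}=jm_2+\gamma^{(2)}_{ij}m_0$, where $\gamma^{(2)}_{ij}=i-j-1$ if $i>j+1$ and $0$ if $i\le j+1$. $\bullet$ For $k=3,4$: $\mathcal B_k=(b^{(k)}_{ij})_{(n+1)\times n}$, $b^{(k)}_{ij}=jm_k+\gamma_{ij}m_0$, where $\gamma_{ij}=i-j-1$ if $i>j+1$ and $0$ if $i\le j+1$. $\bullet$ $\mathcal B_5=(b^{(5)}_{ij})_{(n+1)\times\frac n2}$ and $\mathcal B_6=(b^{(6)}_{ij})_{(n+1)\times\frac n2}$, with $b^{(5)}_{ij}=m_1+jm_2+\alpha_{ij}m_0$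 and $b^{(6)}_{ij}=m_3+jm_2+\alpha_{ij}m_0$, where $\alpha_{ij}=i-j-2$ if $i>j+2$ and $0$ if $i\le j+2$. $\bullet$ $\mathcal B_7=\begin{pmatrix}Q_{1,7}&\cdots&Q_{\frac n2-1,7}\end{pmatrix}$, $Q_{s,7}=(q^{(s7)}_{ij})_{(n+1)\times(\frac n2-s)}$, $q^{(s7)}_{ij}=2sm_4+jm_2+\delta^{(s7)}_{ij}m_0$, where $\delta^{(s7)}_{ij}=i-j-2s-1$ if $i>j+2s+1$ and $0$ if $i\le j+2s+1$. $\bullet$ $\mathcal B_8=\begin{pmatrix}Q_{1,8}&\cdots&Q_{\frac n2,8}\end{pmatrix}$, $Q_{s,8}=(q^{(s8)}_{ij})_{(n+1)\times(\frac n2+1-s)}$, $q^{(s8)}_{ij}=(2s-1)m_4+jm_2+\delta^{(s8)}_{ij}m_0$, where $\delta^{(s8)}_{ij}=i-j-2s$ if $i>j+2s$ and $0$ if $i\le j+2s$. $\bullet$ $\mathcal B_9=\begin{pmatrix}Q_{1,9}&\cdots&Q_{n-1,9}\end{pmatrix}$, $Q_{s,9}=(q^{(s9)}_{ij})_{(n+1)\times(n-s)}$, $q^{(s9)}_{ij}=(n-s-j+1)m_4+jm_3+\delta^{(s9)}_{ij}m_0$, where $\delta^{(s9)}_{ij}=i+s-n-2$ if $i+s>n+2$ and $0$ if $i+s\le n+2$. $\bullet$ $\mathcal B_{10}=\begin{pmatrix}Q_{1,10}&\cdots&Q_{\frac n2-1,10}\end{pmatrix}$, $Q_{s,10}=(q^{(s10)}_{ij})_{(n+1)\times(\frac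 n2-s)}$, $q^{(s10)}_{ij}=2sm_4+jm_2+m_3+\delta^{(s10)}_{ij}m_0$, where $\delta^{(s10)}_{ij}=i-j-2s-2$ if $i>j+2s+2$ and $0$ if $i\le j+2s+2$. $\bullet$ $\mathcal B_{11}=\begin{pmatrix}Q_{1,11}&\cdots&Q_{\frac n2-1,11}\end{pmatrix}$, $Q_{s,11}=(q^{(s11)}_{ij})_{(n+1)\times(\frac n2+1-s)}$, $q^{(s11)}_{ij}=(2s-1)m_4+jm_2+m_3+\delta^{(s11)}_{ij}m_0$, where $\delta^{(s11)}_{ij}=i-j-2s-1$ if $i>j+2s+1$ and $0$ if $i\le j+2s+1$.
   Context: For a numerical semigroup $\Gamma$ with multiplicity (least positive element) $a_1$, the Apéry set is $\mathrm{Ap}(\Gamma,a_1)=\{s\in\Gamma\mid s-a_1\notin\Gamma\}=\{\omega_0=0,\omega_1,\dots,\omega_{a_1-1}\}$. Let $M=\Gamma\setminus\{0\}$ and $sM=M+\dots+M$ ($s$ copies), and let the reduction number be $r=\min\{r\mid (r+1)M=a_1+rM\}$. Define $\omega_{0,i}=\omega_i$, $\omega_{1,0}=a_1$, $\omega_{1,i}=\omega_i$ for $1\le i\le a_1-1$, and inductively for $s\ge 1$: $\omega_{s+1,i}=\omega_{s,i}$ if $\omega_{s,i}\in (s+1)M$, and $\omega_{s+1,i}=\omega_{s,i}+a_1$ otherwise. The Apéry table $\mathrm{AT}(\Gamma,a_1)$ is the $(r+1)\times a_1$ table whose row number $s$ ($0\le s\le r$) is $(\omega_{s,0},\dots,\omega_{s,a_1-1})$.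 In the matrix notation of the claim, rows are indexed from $1$, so matrix row $i$ is row $s=i-1$ of the table. *)

theory Defs
  imports
    "HOL-Library.Set_Algebras"
    "Jordan_Normal_Form.Matrix"
begin

section \<open>Numerical semigroups and Apery tables\<close>

definition numerical_semigroup :: "nat set \<Rightarrow> bool" where
  "numerical_semigroup \<Gamma> \<longleftrightarrow> 0 \<in> \<Gamma> \<and> (\<forall>x\<in>\<Gamma>. \<forall>y\<in>\<Gamma>. x + y \<in> \<Gamma>) \<and> finite (- \<Gamma>)"

text \<open>Intended for finite \<open>G\<close> only.\<close>

definition semigroup_generated :: "nat set \<Rightarrow> nat set" where
  "semigroup_generated G = {\<Sum>g\<in>G. c g * g | c :: nat \<Rightarrow> nat. True}"

definition semigroup_multiplicity :: "nat set \<Rightarrow> nat" where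
  "semigroup_multiplicity \<Gamma> = (LEAST x. x \<in> \<Gamma> \<and> 0 < x)"

text \<open>The difference \<open>s - a\<close> is taken in the integers.\<close>

definition apery_set :: "nat set \<Rightarrow> nat \<Rightarrow> nat set" where
  "apery_set \<Gamma> a = {s \<in> \<Gamma>. int s - int a \<notin> int ` \<Gamma>}"

definition max_ideal :: "nat set \<Rightarrow> nat set" where
  "max_ideal \<Gamma> = \<Gamma> - {0}"

text \<open>
  \<open>M + \<dots> + M\<close> (\<open>s\<close> copies), with \<open>+\<close> the sumset operation of
  \<^theory>\<open>HOL-Library.Set_Algebras\<close>. For \<open>s = 0\<close> this is \<open>{0}\<close>; the other common
  convention, \<open>0 M = \<Gamma>\<close>, changes the reduction number below only for \<open>\<Gamma> = \<nat>\<close>.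
\<close>

definition copies_sum :: "nat \<Rightarrow> nat set \<Rightarrow> nat set" where
  "copies_sum s M = (\<Sum>_\<in>{..<s}. M)"

definition reduction_number :: "nat set \<Rightarrow> nat \<Rightarrow> nat" where
  "reduction_number \<Gamma> a =
     (LEAST r. copies_sum (r + 1) (max_ideal \<Gamma>) = a +o copies_sum r (max_ideal \<Gamma>))"

text \<open>
  An indexing \<open>\<omega> 0 = 0, \<omega> 1, \<dots>, \<omega> (a - 1)\<close> of the Apery set without repetitions; the Apery
  table depends on it only through the order of its columns.
\<close>

definition apery_indexing :: "nat set \<Rightarrow> nat \<Rightarrow> (nat \<Rightarrow> nat) \<Rightarrow> bool" where
  "apery_indexing \<Gamma> a \<omega> \<longleftrightarrow> bij_betw \<omega> {..<a} (apery_set \<Gamma> a) \<and> \<omega> 0 = 0"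

fun apery_entry :: "nat set \<Rightarrow> nat \<Rightarrow> (nat \<Rightarrow> nat) \<Rightarrow> nat \<Rightarrow> nat \<Rightarrow> nat" where
  "apery_entry \<Gamma> a \<omega> 0 i = \<omega> i"
| "apery_entry \<Gamma> a \<omega> (Suc 0) i = (if i = 0 then a else \<omega> i)"
| "apery_entry \<Gamma> a \<omega> (Suc (Suc s)) i =
     (let x = apery_entry \<Gamma> a \<omega> (Suc s) i
      in if x \<in> copies_sum (Suc (Suc s)) (max_ideal \<Gamma>) then x else x + a)"

definition apery_table :: "nat set \<Rightarrow> nat \<Rightarrow> (nat \<Rightarrow> nat) \<Rightarrow> nat mat" where
  "apery_table \<Gamma> a \<omega> =
     mat (reduction_number \<Gamma> a + 1) a (\<lambda>(s, i). apery_entry \<Gamma> a \<omega> s i)"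


section \<open>The semigroup with five generators\<close>

definition gen5 :: "nat \<Rightarrow> nat \<Rightarrow> nat" where
  "gen5 n k = [n^2 + 3*n + 1, n^2 + 3*n + 2, n^2 + 3*n + 3, n^2 + 4*n + 3, n^2 + 4*n + 4] ! k"

definition semigroup5 :: "nat \<Rightarrow> nat set" where
  "semigroup5 n = semigroup_generated {gen5 n 0, gen5 n 1, gen5 n 2, gen5 n 3, gen5 n 4}"


section \<open>The block matrix\<close>

text \<open>
  Library matrices are indexed from 0. The blocks below are given by formulas in indices
  starting at 1, hence the shift.
\<close>

definition mat_from1 :: "nat \<Rightarrow> nat \<Rightarrow> (nat \<Rightarrow> nat \<Rightarrow> nat) \<Rightarrow> nat mat" where
  "mat_from1 nr nc f = mat nr nc (\<lambda>(i, j). f (i + 1) (j + 1))"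

text \<open>Juxtaposition \<open>(A\<^sub>1 \<dots> A\<^sub>k)\<close> of matrices that all have \<open>nr\<close> rows.\<close>

definition block_row :: "nat \<Rightarrow> nat mat list \<Rightarrow> nat mat" where
  "block_row nr As = mat_of_cols nr (concat (map cols As))"

text \<open>
  In the blocks, \<open>n\<close> is even and at least 8, so \<open>n div 2\<close> is exact. Every subtraction is
  either guarded by the accompanying condition or nonnegative on the index range of its
  block, so truncation does not occur. The list \<open>[1..<k]\<close> ends at \<open>k - 1\<close>.
\<close>

definition B1 :: "nat \<Rightarrow> nat mat" where
  "B1 n = mat_from1 (n + 1) 2 (\<lambda>i j.
     if j = 1 then (i - 1) * gen5 n 0
     else if i \<le> 2 then gen5 n 1
     else gen5 n 1 + (i - 2) * gen5 n 0)"

definition B2 :: "nat \<Rightarrow> nat mat" where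
  "B2 n = mat_from1 (n + 1) (n div 2) (\<lambda>i j.
     j * gen5 n 2 + (if i > j + 1 then i - j - 1 else 0) * gen5 n 0)"

definition B34 :: "nat \<Rightarrow> nat \<Rightarrow> nat mat" where
  "B34 n k = mat_from1 (n + 1) n (\<lambda>i j.
     j * gen5 n k + (if i > j + 1 then i - j - 1 else 0) * gen5 n 0)"

definition B5 :: "nat \<Rightarrow> nat mat" where
  "B5 n = mat_from1 (n + 1) (n div 2) (\<lambda>i j.
     gen5 n 1 + j * gen5 n 2 + (if i > j + 2 then i - j - 2 else 0) * gen5 n 0)"

definition B6 :: "nat \<Rightarrow> nat mat" where
  "B6 n = mat_from1 (n + 1) (n div 2) (\<lambda>i j.
     gen5 n 3 + j * gen5 n 2 + (if i > j + 2 then i - j - 2 else 0) * gen5 n 0)"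

definition Q7 :: "nat \<Rightarrow> nat \<Rightarrow> nat mat" where
  "Q7 n s = mat_from1 (n + 1) (n div 2 - s) (\<lambda>i j.
     2 * s * gen5 n 4 + j * gen5 n 2
     + (if i > j + 2 * s + 1 then i - j - 2 * s - 1 else 0) * gen5 n 0)"

definition B7 :: "nat \<Rightarrow> nat mat" where
  "B7 n = block_row (n + 1) (map (Q7 n) [1..<n div 2])"

definition Q8 :: "nat \<Rightarrow> nat \<Rightarrow> nat mat" where
  "Q8 n s = mat_from1 (n + 1) (n div 2 + 1 - s) (\<lambda>i j.
     (2 * s - 1) * gen5 n 4 + j * gen5 n 2
     + (if i > j + 2 * s then i - j - 2 * s else 0) * gen5 n 0)"

definition B8 :: "nat \<Rightarrow> nat mat" where
  "B8 n = block_row (n + 1) (map (Q8 n) [1..<n div 2 + 1])"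

definition Q9 :: "nat \<Rightarrow> nat \<Rightarrow> nat mat" where
  "Q9 n s = mat_from1 (n + 1) (n - s) (\<lambda>i j.
     (n - s - j + 1) * gen5 n 4 + j * gen5 n 3
     + (if i + s > n + 2 then i + s - n - 2 else 0) * gen5 n 0)"

definition B9 :: "nat \<Rightarrow> nat mat" where
  "B9 n = block_row (n + 1) (map (Q9 n) [1..<n])"

definition Q10 :: "nat \<Rightarrow> nat \<Rightarrow> nat mat" where
  "Q10 n s = mat_from1 (n + 1) (n div 2 - s) (\<lambda>i j.
     2 * s * gen5 n 4 + j * gen5 n 2 + gen5 n 3
     + (if i > j + 2 * s + 2 then i - j - 2 * s - 2 else 0) * gen5 n 0)"

definition B10 :: "nat \<Rightarrow> nat mat" where
  "B10 n = block_row (n + 1) (map (Q10 n) [1..<n div 2])"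

definition Q11 :: "nat \<Rightarrow> nat \<Rightarrow> nat mat" where
  "Q11 n s = mat_from1 (n + 1) (n div 2 + 1 - s) (\<lambda>i j.
     (2 * s - 1) * gen5 n 4 + j * gen5 n 2 + gen5 n 3
     + (if i > j + 2 * s + 1 then i - j - 2 * s - 1 else 0) * gen5 n 0)"

definition B11 :: "nat \<Rightarrow> nat mat" where
  "B11 n = block_row (n + 1) (map (Q11 n) [1..<n div 2])"

definition block_matrix :: "nat \<Rightarrow> nat mat" where
  "block_matrix n = block_row (n + 1)
     [B1 n, B2 n, B34 n 3, B34 n 4, B5 n, B6 n, B7 n, B8 n, B9 n, B10 n, B11 n]"

end

theory Submission
  imports Defs
begin

text \<open>
  Write \<open>m\<close> for the multiplicity \<open>gen5 n 0 = n\<^sup>2 + 3 n + 1\<close>. The five generators are \<open>m + d\<close> with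
  offsets \<open>d = 0, 1, 2, n + 2, n + 3\<close>, so a number lies in the semigroup iff it is \<open>d m + e\<close> with
  \<open>e\<close> a sum of at most \<open>d\<close> of the offsets \<open>1, 2, n + 2, n + 3\<close>. Call the least number of offsets
  needed for \<open>e\<close> the level of \<open>e\<close>.

  Two facts about levels carry the argument. Every \<open>e < m\<close> has level at most \<open>n\<close>; and every
  \<open>e \<ge> m\<close> has level greater than \<open>n\<close>, because \<open>n\<close> offsets add up to at most \<open>n (n + 3) = m - 1\<close>.
  So replacing the residue of a number by a larger representative, with a smaller multiple of \<open>m\<close>,
  never helps: \<open>x\<close> is in the semigroup iff the level of \<open>x mod m\<close> is at most \<open>x div m\<close>
  (\<open>mem_semigroup5_iff\<close>), and in that case \<open>x\<close> is a sum of \<open>s\<close> nonzero elements iff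
  \<open>0 < s \<le> x div m\<close> (\<open>copies_sum_max_ideal\<close>).

  Everything in the theorem is then read off from levels, in the locale
  \<open>leveled_semigroup\<close>: the Apery element of the residue \<open>e\<close> is \<open>level e * m + e\<close>, its entry in row
  \<open>s\<close> of the table is \<open>max s (level e) * m + e\<close>, and the reduction number is the largest level,
  here \<open>n\<close>.

  It remains to recognise the matrix. Writing \<open>e = c (n + 2) + r\<close> with \<open>r < n + 2\<close>, the level is
  \<open>c\<close> if \<open>r \<le> c\<close> and \<open>c\<close> plus half of \<open>r - c\<close>, rounded up, otherwise. Each column of each block
  consists of the entries just described for one cell \<open>(c, r)\<close> (\<open>cols_block_matrix\<close>). The blocks
  sort the cells by their position relative to the lines \<open>c = 0\<close>, \<open>r = 0\<close>, \<open>r = c\<close> and by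
  parities; they reach every cell (\<open>cells_subset_block_cells\<close>), and since there are exactly as
  many columns as cells (\<open>length_block_cells\<close>), each cell occurs once.
\<close>

section \<open>Semigroups graded by the level of a residue\<close>

text \<open>
  The level of a residue \<open>e\<close> is the quotient by \<open>a\<close> of the first element of \<open>\<Gamma>\<close> in the class of
  \<open>e\<close>. The last assumption makes the sets of \<open>s\<close>-fold sums of nonzero elements as large as
  possible: from a nonzero Apery element it splits off a summand \<open>a + d\<close> that uses up a single
  multiple of \<open>a\<close>.
\<close>

locale leveled_semigroup =
  fixes \<Gamma> :: "nat set" and a :: nat and level :: "nat \<Rightarrow> nat"
  assumes a_pos: "0 < a"
    and mem_iff: "x \<in> \<Gamma> \<longleftrightarrow> level (x mod a) \<le> x div a"
    and closed: "x \<in> \<Gamma> \<Longrightarrow> y \<in> \<Gamma> \<Longrightarrow> x + y \<in> \<Gamma>"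
    and level_0_iff: "e < a \<Longrightarrow> level e = 0 \<longleftrightarrow> e = 0"
    and peel: "0 < e \<Longrightarrow> e < a \<Longrightarrow> \<exists>d\<le>e. a + d \<in> \<Gamma> \<and> level (e - d) < level e"
begin

lemma mem_split: "e < a \<Longrightarrow> q * a + e \<in> \<Gamma> \<longleftrightarrow> level e \<le> q"
  using a_pos by (simp add: mem_iff)

lemma zero_mem: "0 \<in> \<Gamma>"
  using level_0_iff[of 0] a_pos by (simp add: mem_iff)

lemma a_mem: "a \<in> \<Gamma>"
  using level_0_iff[of 0] a_pos by (simp add: mem_iff)

lemma div_pos_iff:
  assumes "x \<in> \<Gamma>"
  shows "1 \<le> x div a \<longleftrightarrow> x \<noteq> 0"
proof
  assume "x \<noteq> 0"
  show "1 \<le> x div a"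
  proof (rule ccontr)
    assume "\<not> 1 \<le> x div a"
    then have "x div a = 0" by simp
    then have "x < a" using a_pos by (simp add: div_eq_0_iff)
    then show False using assms \<open>x \<noteq> 0\<close> level_0_iff[of x] by (simp add: mem_iff)
  qed
qed (cases "x = 0", simp_all)

lemma multiplicity: "semigroup_multiplicity \<Gamma> = a"
  unfolding semigroup_multiplicity_def
proof (rule Least_equality)
  fix y assume "y \<in> \<Gamma> \<and> 0 < y"
  then have "1 \<le> y div a" using div_pos_iff by simp
  then have "a * 1 \<le> a * (y div a)" by simp
  also have "\<dots> \<le> y" by simp
  finally show "a \<le> y" by simp
qed (use a_mem a_pos in simp)

lemma split_off_element:
  assumes x: "x \<in> \<Gamma>" and q: "x div a = Suc q"
  shows "\<exists>y\<in>\<Gamma>. \<exists>z\<in>\<Gamma> - {0}. x = y + z \<and> y div a = q"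
proof -
  define e where "e = x mod a"
  have e: "e < a" using a_pos by (simp add: e_def)
  have x_eq: "x = Suc q * a + e"
    using div_mult_mod_eq[of x a] q by (simp add: e_def)
  show ?thesis
  proof (cases "level e \<le> q")
    case True
    have "q * a + e \<in> \<Gamma>" "(q * a + e) div a = q"
      using mem_split[OF e] True e by auto
    then show ?thesis using a_mem a_pos x_eq by (intro bexI[of _ "q * a + e"] bexI[of _ a]) auto
  next
    case False
    have "level e \<le> Suc q" using x mem_split[OF e, of "Suc q"] by (simp only: x_eq)
    moreover have "0 < e" using False level_0_iff[OF e] by (cases "e = 0") auto
    ultimately obtain d where d: "d \<le> e" "a + d \<in> \<Gamma>" "level (e - d) \<le> q"
      using peel[OF _ e] by fastforce
    then obtain f where f: "e = d + f" using le_Suc_ex by blast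
    have "f < a" "level f \<le> q" using e d(3) f by auto
    then have "q * a + f \<in> \<Gamma>" "(q * a + f) div a = q" using mem_split by auto
    then show ?thesis using d(2) x_eq f a_pos
      by (intro bexI[of _ "q * a + f"] bexI[of _ "a + d"]) auto
  qed
qed

text \<open>
  Nonzero elements have quotient at least 1 by \<open>a\<close> and quotients are superadditive, which bounds
  the number of summands; conversely summands of quotient 1 can be split off one at a time.
\<close>
lemma copies_sum_max_ideal:
  "0 < s \<Longrightarrow> copies_sum s (max_ideal \<Gamma>) = {x \<in> \<Gamma>. s \<le> x div a}"
proof (induction s rule: nat_induct_non_zero)
  case 1
  show ?case using div_pos_iff by (auto simp: copies_sum_def max_ideal_def)
next
  case (Suc s)
  have step: "copies_sum (Suc s) (max_ideal \<Gamma>) = copies_sum s (max_ideal \<Gamma>) + max_ideal \<Gamma>"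
    by (simp add: copies_sum_def lessThan_Suc add.commute)
  show ?case unfolding step Suc.IH
  proof (intro equalityI subsetI)
    fix x assume "x \<in> {x \<in> \<Gamma>. s \<le> x div a} + max_ideal \<Gamma>"
    then obtain y z where yz: "x = y + z" "y \<in> \<Gamma>" "s \<le> y div a" "z \<in> \<Gamma>" "1 \<le> z div a"
      using div_pos_iff by (auto simp: max_ideal_def elim!: set_plus_elim)
    have "Suc s \<le> y div a + z div a" using yz by simp
    also have "\<dots> \<le> x div a" unfolding yz(1) by (subst div_add1_eq) (rule le_add1)
    finally show "x \<in> {x \<in> \<Gamma>. Suc s \<le> x div a}" using yz closed by auto
  next
    fix x assume "x \<in> {x \<in> \<Gamma>. Suc s \<le> x div a}"
    then have x: "x \<in> \<Gamma>" "x div a = Suc (x div a - 1)" "s \<le> x div a - 1" by auto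
    obtain y z where yz: "y \<in> \<Gamma>" "z \<in> \<Gamma> - {0}" "x = y + z" "y div a = x div a - 1"
      using split_off_element[OF x(1,2)] by blast
    have "s \<le> y div a" using x(3) yz(4) by simp
    then show "x \<in> {x \<in> \<Gamma>. s \<le> x div a} + max_ideal \<Gamma>"
      using yz(1,2) unfolding yz(3) by (intro set_plus_intro) (auto simp: max_ideal_def)
  qed
qed

lemma apery_set_eq: "apery_set \<Gamma> a = (\<lambda>e. level e * a + e) ` {..<a}"
proof (intro equalityI subsetI)
  fix x assume "x \<in> apery_set \<Gamma> a"
  then have x: "x \<in> \<Gamma>" "int x - int a \<notin> int ` \<Gamma>" by (auto simp: apery_set_def)
  define e q where "e = x mod a" and "q = x div a"
  have e: "e < a" using a_pos by (simp add: e_def)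
  have x_eq: "x = q * a + e" by (simp add: e_def q_def)
  have le: "level e \<le> q" using x(1) mem_split[OF e] by (simp only: x_eq)
  have "level e = q"
  proof (rule ccontr)
    assume "level e \<noteq> q"
    then obtain p where p: "q = Suc p" "level e \<le> p" using le by (cases q) auto
    then have "p * a + e \<in> \<Gamma>" using mem_split[OF e] by simp
    moreover have "int x - int a = int (p * a + e)" using p x_eq by simp
    ultimately show False using x(2) by blast
  qed
  then show "x \<in> (\<lambda>e. level e * a + e) ` {..<a}" using e x_eq by blast
next
  fix x assume "x \<in> (\<lambda>e. level e * a + e) ` {..<a}"
  then obtain e where e: "e < a" "x = level e * a + e" by auto
  have "int x - int a \<noteq> int y" if "y \<in> \<Gamma>" for y
  proof
    assume "int x - int a = int y"
    then have *: "level e * a + e = y + a" using e by linarith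
    have "e = y mod a" using arg_cong[OF *, of "\<lambda>t. t mod a"] e(1) by simp
    moreover have "level e = Suc (y div a)"
      using arg_cong[OF *, of "\<lambda>t. t div a"] e(1) a_pos by simp
    ultimately show False using that by (simp add: mem_iff)
  qed
  then show "x \<in> apery_set \<Gamma> a" using e mem_split[OF e(1)] by (auto simp: apery_set_def)
qed

text \<open>
  A column stays constant while its entry still has enough quotient to be a sum of the required
  number of elements, that is up to row \<open>level (e i)\<close>, and grows by \<open>a\<close> in every later row. The second
  condition on \<open>e\<close> identifies the column of 0, whose entry in row 1 is \<open>a\<close> by convention.
\<close>
lemma apery_entry_eq:
  assumes \<omega>: "\<And>i. i < a \<Longrightarrow> \<omega> i = level (e i) * a + e i"
    and e: "\<And>i. i < a \<Longrightarrow> e i < a" "\<And>i. i < a \<Longrightarrow> e i = 0 \<longleftrightarrow> i = 0"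
    and i: "i < a"
  shows "apery_entry \<Gamma> a \<omega> s i = max s (level (e i)) * a + e i"
proof (induction s rule: induct_nat_012)
  case 0
  show ?case using \<omega>[OF i] by simp
next
  case 1
  show ?case
  proof (cases "i = 0")
    case True
    then show ?thesis using e(2)[OF i] level_0_iff[OF e(1)[OF i]] by simp
  next
    case False
    then have "1 \<le> level (e i)" using e(2)[OF i] level_0_iff[OF e(1)[OF i]] by simp
    then show ?thesis using \<omega>[OF i] False by (simp add: max_def)
  qed
next
  case (ge2 s)
  define L where "L = level (e i)"
  have "max (Suc s) L * a + e i \<in> copies_sum (Suc (Suc s)) (max_ideal \<Gamma>)
      \<longleftrightarrow> Suc (Suc s) \<le> L"
    using e(1)[OF i] mem_split[OF e(1)[OF i]] a_pos
    by (auto simp: copies_sum_max_ideal L_def)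
  then have step: "apery_entry \<Gamma> a \<omega> (Suc (Suc s)) i
      = (if Suc (Suc s) \<le> L then max (Suc s) L * a + e i else max (Suc s) L * a + e i + a)"
    using ge2.IH(2) by (simp add: Let_def L_def)
  show ?case
  proof (cases "Suc (Suc s) \<le> L")
    case True
    then show ?thesis unfolding step by (simp add: L_def max_def)
  next
    case False
    then have "max (Suc s) L = Suc s" "max (Suc (Suc s)) L = Suc (Suc s)" by auto
    then show ?thesis unfolding step using False by (simp add: L_def[symmetric])
  qed
qed

text \<open>
  Subtracting \<open>a\<close> from \<open>x\<close> leaves the semigroup exactly when the quotient of \<open>x\<close> equals the
  level of its residue. This is impossible for quotients above the largest level \<open>r\<close>, while the
  Apery element of level \<open>r\<close> obstructs every smaller reduction number.
\<close>
lemma reduction_number_eq: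
  assumes bound: "\<And>e. e < a \<Longrightarrow> level e \<le> r"
    and top: "e < a" "level e = r" and r: "0 < r"
  shows "reduction_number \<Gamma> a = r"
  unfolding reduction_number_def
proof (rule Least_equality)
  show "copies_sum (r + 1) (max_ideal \<Gamma>) = a +o copies_sum r (max_ideal \<Gamma>)"
  proof (intro equalityI subsetI)
    fix x assume "x \<in> copies_sum (r + 1) (max_ideal \<Gamma>)"
    then have q: "r + 1 \<le> x div a" by (simp add: copies_sum_max_ideal)
    define p where "p = x div a - 1"
    have p: "x div a = Suc p" "r \<le> p" using q by (auto simp: p_def)
    have e: "x mod a < a" using a_pos by simp
    have "x = a + (p * a + x mod a)" using div_mult_mod_eq[of x a] p by simp
    moreover have "p * a + x mod a \<in> copies_sum r (max_ideal \<Gamma>)"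
      using mem_split[OF e] bound[OF e] p(2) r a_pos by (auto simp: copies_sum_max_ideal)
    ultimately show "x \<in> a +o copies_sum r (max_ideal \<Gamma>)" by (auto simp: elt_set_plus_def)
  next
    fix x assume "x \<in> a +o copies_sum r (max_ideal \<Gamma>)"
    then obtain y where "x = a + y" "y \<in> \<Gamma>" "r \<le> y div a"
      using r by (auto simp: elt_set_plus_def copies_sum_max_ideal)
    then show "x \<in> copies_sum (r + 1) (max_ideal \<Gamma>)"
      using closed[OF a_mem] a_pos by (simp add: copies_sum_max_ideal)
  qed
next
  fix t assume t: "copies_sum (t + 1) (max_ideal \<Gamma>) = a +o copies_sum t (max_ideal \<Gamma>)"
  show "r \<le> t"
  proof (rule ccontr)
    assume "\<not> r \<le> t"
    then have "r * a + e \<in> copies_sum (t + 1) (max_ideal \<Gamma>)"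
      using mem_split[OF top(1)] top a_pos by (auto simp: copies_sum_max_ideal)
    then obtain y where y: "r * a + e = a + y" "y \<in> copies_sum t (max_ideal \<Gamma>)"
      unfolding t by (auto simp: elt_set_plus_def)
    have "y \<in> \<Gamma>"
    proof (cases "t = 0")
      case True
      then show ?thesis using y(2) zero_mem by (simp add: copies_sum_def)
    next
      case False
      then show ?thesis using y(2) by (simp add: copies_sum_max_ideal)
    qed
    moreover have "r * a + e \<in> apery_set \<Gamma> a"
      unfolding apery_set_eq using top by auto
    ultimately show False using y(1) by (auto simp: apery_set_def)
  qed
qed

end

section \<open>Levels for the five generators\<close>

text \<open>
  The least number of offsets adding up to \<open>c (n + 2) + r\<close>, as long as this is below
  \<open>gen5 n 0\<close>: with \<open>b\<close> offsets \<open>n + 2\<close> or \<open>n + 3\<close>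
  one reaches every value from \<open>b (n + 2)\<close> to \<open>b (n + 3)\<close>, so with \<open>b = c\<close> only \<open>r - c\<close> is
  left, to be filled by \<open>2\<close>s and at most one \<open>1\<close>. The subtraction is truncated on purpose.
\<close>

definition cell_level :: "nat \<Rightarrow> nat \<Rightarrow> nat" where
  "cell_level c r = c + (r - c + 1) div 2"

definition level5 :: "nat \<Rightarrow> nat \<Rightarrow> nat" where
  "level5 n e = cell_level (e div (n + 2)) (e mod (n + 2))"

text \<open>The pairs of quotient and remainder modulo \<open>n + 2\<close> of the numbers below \<open>gen5 n 0\<close>.\<close>

definition cells :: "nat \<Rightarrow> (nat \<times> nat) set" where
  "cells n = {(c, r). c \<le> n \<and> r \<le> n + 1 \<and> (c = n \<longrightarrow> r \<le> n)}"

definition cell_offset :: "nat \<Rightarrow> nat \<times> nat \<Rightarrow> nat" where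
  "cell_offset n = (\<lambda>(c, r). c * (n + 2) + r)"

lemma gen5_simps:
  "gen5 n 1 = gen5 n 0 + 1" "gen5 n (Suc 0) = gen5 n 0 + 1" "gen5 n 2 = gen5 n 0 + 2"
  "gen5 n 3 = gen5 n 0 + (n + 2)" "gen5 n 4 = gen5 n 0 + (n + 3)"
  by (simp_all add: gen5_def numeral_eq_Suc)

lemma gen5_0: "gen5 n 0 = n * (n + 2) + (n + 1)"
  by (simp add: gen5_def power2_eq_square algebra_simps)

lemma gen5_0_pos: "0 < gen5 n 0"
  by (simp add: gen5_0)

lemma cell_offset_div_mod:
  assumes "r \<le> n + 1"
  shows "cell_offset n (c, r) div (n + 2) = c" "cell_offset n (c, r) mod (n + 2) = r"
proof -
  have r: "r < n + 2" using assms by simp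
  show "cell_offset n (c, r) div (n + 2) = c"
    using r div_mult_self3[of "n + 2" c r] by (simp only: cell_offset_def prod.case) simp
  show "cell_offset n (c, r) mod (n + 2) = r"
    using r by (simp only: cell_offset_def prod.case mod_mult_self3 mod_less)
qed

lemma level5_cell_offset: "r \<le> n + 1 \<Longrightarrow> level5 n (cell_offset n (c, r)) = cell_level c r"
  by (simp only: level5_def cell_offset_div_mod)

lemma cell_offset_less:
  assumes "(c, r) \<in> cells n"
  shows "cell_offset n (c, r) < gen5 n 0"
proof (cases "c = n")
  case True
  then show ?thesis using assms by (simp add: cells_def cell_offset_def gen5_0)
next
  case False
  then have "c + 1 \<le> n" "r \<le> n + 1" using assms by (auto simp: cells_def)
  then have "(c + 1) * (n + 2) \<le> n * (n + 2)" by (intro mult_right_mono) auto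
  then show ?thesis using \<open>r \<le> n + 1\<close> by (simp add: cell_offset_def gen5_0)
qed

lemma cell_of_offset:
  assumes "e < gen5 n 0"
  shows "(e div (n + 2), e mod (n + 2)) \<in> cells n"
    and "cell_offset n (e div (n + 2), e mod (n + 2)) = e"
proof -
  define c r where "c = e div (n + 2)" and "r = e mod (n + 2)"
  have e: "e = c * (n + 2) + r" unfolding c_def r_def by (rule div_mult_mod_eq[symmetric])
  have r: "r < n + 2" by (simp add: r_def)
  have "c < n + 1"
  proof (rule ccontr)
    assume "\<not> c < n + 1"
    then have "(n + 1) * (n + 2) \<le> c * (n + 2)" by (intro mult_right_mono) auto
    then show False using assms e by (simp add: gen5_0 algebra_simps)
  qed
  moreover have "c = n \<Longrightarrow> r \<le> n" using assms e by (simp add: gen5_0)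
  ultimately show "(e div (n + 2), e mod (n + 2)) \<in> cells n"
    using r by (simp add: cells_def c_def r_def)
  show "cell_offset n (e div (n + 2), e mod (n + 2)) = e"
    by (simp only: cell_offset_def prod.case div_mult_mod_eq)
qed

lemma cell_offset_bij: "bij_betw (cell_offset n) (cells n) {..<gen5 n 0}"
proof (rule bij_betw_byWitness[where f' = "\<lambda>e. (e div (n + 2), e mod (n + 2))"])
  show "\<forall>p\<in>cells n. (cell_offset n p div (n + 2), cell_offset n p mod (n + 2)) = p"
    by (auto simp: cells_def cell_offset_div_mod simp del: add_2_eq_Suc')
qed (use cell_of_offset cell_offset_less in auto)

text \<open>
  With \<open>k = n - c\<close> at least 1, the worst case \<open>r = n + 1\<close> needs half of \<open>k + 1\<close>, rounded up,
  offsets besides the \<open>c\<close> large ones, and that is at most \<open>k\<close>. For \<open>c = n\<close> the bound depends on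
  \<open>r \<le> n\<close>: the excluded cell \<open>(n, n + 1)\<close> has level \<open>n + 1\<close>.
\<close>
lemma cell_level_le:
  assumes "1 \<le> n" "(c, r) \<in> cells n"
  shows "cell_level c r \<le> n"
  using assms by (auto simp: cells_def cell_level_def)

lemma level5_le: "1 \<le> n \<Longrightarrow> e < gen5 n 0 \<Longrightarrow> level5 n e \<le> n"
  using cell_level_le cell_of_offset(1) by (simp add: level5_def)

lemma semigroup5_iff:
  assumes n: "1 \<le> n"
  shows "x \<in> semigroup5 n \<longleftrightarrow> (\<exists>c0 c1 c2 c3 c4.
     x = (c0 + c1 + c2 + c3 + c4) * gen5 n 0 + (c1 + 2 * c2 + (n + 2) * c3 + (n + 3) * c4))"
    (is "_ \<longleftrightarrow> (\<exists>c0 c1 c2 c3 c4. x = ?sum c0 c1 c2 c3 c4)")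
proof -
  have sum: "(\<Sum>g\<in>{gen5 n 0, gen5 n 1, gen5 n 2, gen5 n 3, gen5 n 4}. c g * g)
      = ?sum (c (gen5 n 0)) (c (gen5 n 1)) (c (gen5 n 2)) (c (gen5 n 3)) (c (gen5 n 4))" for c
    using n by (simp add: gen5_simps algebra_simps)
  have coefficients: "\<exists>c. ?sum c0 c1 c2 c3 c4
      = ?sum (c (gen5 n 0)) (c (gen5 n 1)) (c (gen5 n 2)) (c (gen5 n 3)) (c (gen5 n 4))"
    for c0 c1 c2 c3 c4
    using n
    by (intro exI[of _ "\<lambda>g. if g = gen5 n 0 then c0 else if g = gen5 n 1 then c1
      else if g = gen5 n 2 then c2 else if g = gen5 n 3 then c3 else c4"])
      (simp add: gen5_simps)
  show ?thesis
    unfolding semigroup5_def semigroup_generated_def sum using coefficients by blast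
qed

text \<open>
  A sum equal to \<open>e = c (n + 2) + r\<close> has at most \<open>c\<close> large offsets, and using fewer saves nothing:
  omitting \<open>t > 0\<close> of them leaves \<open>t (n + 2) + r\<close>, of which the excess of the offsets \<open>n + 3\<close>
  over \<open>n + 2\<close> absorbs at most \<open>c \<le> n\<close>, so that at least \<open>2 t + r\<close> remains for the offsets 1 and 2.
\<close>
lemma level5_le_number_of_offsets:
  assumes e: "e < gen5 n 0" and e_eq: "e = c1 + 2 * c2 + (n + 2) * c3 + (n + 3) * c4"
  shows "level5 n e \<le> c1 + c2 + c3 + c4"
proof -
  define c r where "c = e div (n + 2)" and "r = e mod (n + 2)"
  have ecr: "e = c * (n + 2) + r" unfolding c_def r_def by (rule div_mult_mod_eq[symmetric])
  have cn: "c \<le> n" using cell_of_offset(1)[OF e] by (simp add: cells_def c_def)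
  have "c3 + c4 \<le> c"
  proof -
    have "(n + 2) * (c3 + c4) \<le> e" unfolding e_eq by (simp add: algebra_simps)
    then show ?thesis unfolding c_def
      by (simp add: less_eq_div_iff_mult_less_eq mult.commute)
  qed
  \<comment> \<open>\<open>t\<close> counts the omitted large offsets\<close>
  then obtain t where t: "c = c3 + c4 + t" using le_Suc_ex by blast
  have eq: "c1 + 2 * c2 + c4 = t * (n + 2) + r"
    using e_eq unfolding ecr t by (simp add: algebra_simps)
  have "cell_level c r \<le> c1 + c2 + c3 + c4"
  proof (cases "t = 0")
    case True
    then show ?thesis using eq t by (simp add: cell_level_def)
  next
    case False
    then have "n + 2 * t \<le> t * (n + 2)" by (cases t) auto
    then have "n + 2 * t + r \<le> c1 + 2 * c2 + c4" using eq by simp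
    then show ?thesis using t cn unfolding cell_level_def by linarith
  qed
  then show ?thesis by (simp add: level5_def c_def r_def)
qed

lemma offsets_of_level5:
  "\<exists>c1 c2 c3 c4. e = c1 + 2 * c2 + (n + 2) * c3 + (n + 3) * c4
     \<and> c1 + c2 + c3 + c4 = level5 n e"
proof -
  define c r where "c = e div (n + 2)" and "r = e mod (n + 2)"
  have ecr: "e = c * (n + 2) + r" unfolding c_def r_def by (rule div_mult_mod_eq[symmetric])
  have L: "level5 n e = cell_level c r" by (simp add: level5_def c_def r_def)
  have "\<exists>c1 c2 c3 c4. c * (n + 2) + r = c1 + 2 * c2 + (n + 2) * c3 + (n + 3) * c4
     \<and> c1 + c2 + c3 + c4 = cell_level c r"
  proof (cases "r \<le> c")
    case True
    then obtain t where t: "c = r + t" using le_Suc_ex by blast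
    show ?thesis unfolding t
      by (rule exI[of _ 0], rule exI[of _ 0], rule exI[of _ t], rule exI[of _ r])
        (simp add: cell_level_def algebra_simps)
  next
    case False
    then obtain t where t: "r = c + t" using le_Suc_ex by (metis nat_le_linear)
    have parts: "t mod 2 + 2 * (t div 2) = t" "t mod 2 + t div 2 = (t + 1) div 2" by presburger+
    have "(c + t) * 1 + c * (n + 2) = t mod 2 + 2 * (t div 2) + (n + 2) * 0 + (n + 3) * c"
      unfolding parts by (simp add: algebra_simps)
    then have "c * (n + 2) + (c + t) = t mod 2 + 2 * (t div 2) + (n + 2) * 0 + (n + 3) * c" by simp
    moreover have "t mod 2 + t div 2 + 0 + c = cell_level c (c + t)"
      unfolding cell_level_def parts by simp
    ultimately show ?thesis unfolding t by blast
  qed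
  then show ?thesis unfolding L by (simp only: ecr[symmetric])
qed

text \<open>
  A representation \<open>x = d m + e\<close> with \<open>m = gen5 n 0 \<le> e\<close> needs \<open>d > n\<close> generators, since \<open>n\<close>
  offsets sum to at most \<open>n (n + 3) < m\<close>. Then the quotient of \<open>x\<close> exceeds every level below \<open>m\<close>,
  and the criterion holds for \<open>x\<close> anyway.
\<close>
lemma mem_semigroup5_iff:
  assumes n: "1 \<le> n"
  shows "x \<in> semigroup5 n \<longleftrightarrow> level5 n (x mod gen5 n 0) \<le> x div gen5 n 0"
proof
  assume "x \<in> semigroup5 n"
  then obtain c0 c1 c2 c3 c4 where
    x: "x = (c0 + c1 + c2 + c3 + c4) * gen5 n 0 + (c1 + 2 * c2 + (n + 2) * c3 + (n + 3) * c4)"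
    unfolding semigroup5_iff[OF n] by blast
  define d e where "d = c0 + c1 + c2 + c3 + c4"
    and "e = c1 + 2 * c2 + (n + 2) * c3 + (n + 3) * c4"
  have x: "x = d * gen5 n 0 + e" unfolding x d_def e_def ..
  show "level5 n (x mod gen5 n 0) \<le> x div gen5 n 0"
  proof (cases "e < gen5 n 0")
    case True
    then have "level5 n e \<le> d" using level5_le_number_of_offsets[OF True e_def]
      by (simp add: d_def)
    then show ?thesis using True by (simp add: x)
  next
    case False
    have "e \<le> (n + 3) * d" unfolding e_def d_def by (simp add: algebra_simps)
    moreover have "(n + 3) * d \<le> (n + 3) * n" if "d \<le> n" using that by (intro mult_left_mono) auto
    ultimately have "n < d" using False by (auto simp: gen5_0 algebra_simps not_le[symmetric])
    moreover have "d \<le> x div gen5 n 0" using gen5_0_pos[of n] by (simp add: x)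
    moreover have "level5 n (x mod gen5 n 0) \<le> n" using level5_le[OF n] gen5_0_pos[of n] by simp
    ultimately show ?thesis by simp
  qed
next
  assume le: "level5 n (x mod gen5 n 0) \<le> x div gen5 n 0"
  obtain c1 c2 c3 c4 where c: "x mod gen5 n 0 = c1 + 2 * c2 + (n + 2) * c3 + (n + 3) * c4"
    "c1 + c2 + c3 + c4 = level5 n (x mod gen5 n 0)"
    using offsets_of_level5 by blast
  obtain c0 where "x div gen5 n 0 = c1 + c2 + c3 + c4 + c0" using le c(2) le_Suc_ex by metis
  then have "x = (c0 + c1 + c2 + c3 + c4) * gen5 n 0
      + (c1 + 2 * c2 + (n + 2) * c3 + (n + 3) * c4)"
    using div_mult_mod_eq[of x "gen5 n 0"] c(1) by (simp add: add_ac)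
  then show "x \<in> semigroup5 n" unfolding semigroup5_iff[OF n] by blast
qed

lemma semigroup5_closed:
  assumes "x \<in> semigroup5 n" "y \<in> semigroup5 n"
  shows "x + y \<in> semigroup5 n"
proof -
  obtain c d where
    c: "x = (\<Sum>g\<in>{gen5 n 0, gen5 n 1, gen5 n 2, gen5 n 3, gen5 n 4}. c g * g)" and
    d: "y = (\<Sum>g\<in>{gen5 n 0, gen5 n 1, gen5 n 2, gen5 n 3, gen5 n 4}. d g * g)"
    using assms unfolding semigroup5_def semigroup_generated_def by blast
  have "x + y = (\<Sum>g\<in>{gen5 n 0, gen5 n 1, gen5 n 2, gen5 n 3, gen5 n 4}. (c g + d g) * g)"
    unfolding c d by (simp only: sum.distrib add_mult_distrib)
  then show ?thesis unfolding semigroup5_def semigroup_generated_def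
    by (intro CollectI exI[of _ "\<lambda>g. c g + d g"]) simp
qed

lemma level5_0_iff: "level5 n e = 0 \<longleftrightarrow> e = 0"
proof
  assume "level5 n e = 0"
  then have "e div (n + 2) = 0" "e mod (n + 2) = 0" by (auto simp: level5_def cell_level_def)
  then show "e = 0" using div_mult_mod_eq[of e "n + 2"] by simp
qed (simp add: level5_def cell_level_def)

text \<open>
  A shortest sum for the cell \<open>(c, r)\<close> contains the offset \<open>n + 3\<close> if \<open>c, r > 0\<close> (remove it to get
  to \<open>(c - 1, r - 1)\<close>), the offset \<open>n + 2\<close> if \<open>r = 0\<close>, and, if \<open>c = 0\<close>, the offset 2, or 1 when
  \<open>r = 1\<close>.
\<close>
lemma level5_peel:
  assumes n: "1 \<le> n" and e: "0 < e" "e < gen5 n 0"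
  shows "\<exists>d\<le>e. gen5 n 0 + d \<in> semigroup5 n \<and> level5 n (e - d) < level5 n e"
proof -
  have generator: "gen5 n 0 + (c1 + 2 * c2 + (n + 2) * c3 + (n + 3) * c4) \<in> semigroup5 n"
    if "c1 + c2 + c3 + c4 = 1" for c1 c2 c3 c4
    unfolding semigroup5_iff[OF n]
    by (rule exI[of _ 0], rule exI[of _ c1], rule exI[of _ c2], rule exI[of _ c3],
        rule exI[of _ c4]) (simp only: that add_0 mult_1)
  have gens: "gen5 n 0 + d \<in> semigroup5 n" if "d \<in> {1, 2, n + 2, n + 3}" for d
    using generator[of 1 0 0 0] generator[of 0 1 0 0] generator[of 0 0 1 0]
      generator[of 0 0 0 1] that by auto
  define c r where "c = e div (n + 2)" and "r = e mod (n + 2)"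
  have cell: "e = cell_offset n (c, r)" and r: "r \<le> n + 1"
    using cell_of_offset[OF e(2)] by (auto simp: c_def r_def cells_def)
  have pos: "0 < c \<or> 0 < r" using e(1) cell by (auto simp: cell_offset_def)
  have by_cell: ?thesis
    if d: "d \<in> {1, 2, n + 2, n + 3}" and r': "r' \<le> n + 1"
      and eq: "e = cell_offset n (c', r') + d" and less: "cell_level c' r' < cell_level c r"
    for c' r' d
  proof (intro exI[of _ d] conjI)
    have "level5 n (e - d) = cell_level c' r'" using level5_cell_offset[OF r'] eq by simp
    also have "\<dots> < level5 n e" using less level5_cell_offset[OF r] cell by simp
    finally show "level5 n (e - d) < level5 n e" .
  qed (use eq gens[OF d] in auto)
  show ?thesis
  proof (cases "c = 0")
    case True
    show ?thesis using True pos r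
      by (intro by_cell[of "min r 2" "r - min r 2" 0])
        (auto simp: cell cell_offset_def cell_level_def min_def)
  next
    case False
    then obtain c' where c: "c = Suc c'" by (cases c) auto
    show ?thesis
    proof (cases r)
      case 0
      then show ?thesis
        by (intro by_cell[of "n + 2" 0 c']) (auto simp: cell c cell_offset_def cell_level_def)
    next
      case (Suc r')
      then show ?thesis using r
        by (intro by_cell[of "n + 3" r' c']) (auto simp: cell c cell_offset_def cell_level_def)
    qed
  qed
qed

lemma leveled_semigroup5: "1 \<le> n \<Longrightarrow> leveled_semigroup (semigroup5 n) (gen5 n 0) (level5 n)"
  by unfold_locales
    (simp_all add: gen5_0_pos mem_semigroup5_iff[symmetric] semigroup5_closed level5_0_iff level5_peel)

lemma numerical_semigroup5:
  assumes n: "1 \<le> n"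
  shows "numerical_semigroup (semigroup5 n)"
  unfolding numerical_semigroup_def
proof (intro conjI ballI)
  interpret leveled_semigroup "semigroup5 n" "gen5 n 0" "level5 n" by (rule leveled_semigroup5[OF n])
  show "0 \<in> semigroup5 n" by (rule zero_mem)
  have "x < n * gen5 n 0" if "x \<notin> semigroup5 n" for x
  proof -
    have "x div gen5 n 0 < n"
      using that level5_le[OF n, of "x mod gen5 n 0"] a_pos by (simp add: mem_iff)
    then show ?thesis using a_pos by (simp add: div_less_iff_less_mult)
  qed
  then have "- semigroup5 n \<subseteq> {..<n * gen5 n 0}" by auto
  then show "finite (- semigroup5 n)" using finite_subset by blast
qed (rule semigroup5_closed)

lemma reduction_number_semigroup5:
  assumes n: "1 \<le> n"
  shows "reduction_number (semigroup5 n) (gen5 n 0) = n"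
proof -
  interpret leveled_semigroup "semigroup5 n" "gen5 n 0" "level5 n" by (rule leveled_semigroup5[OF n])
  have cell: "(n, 0) \<in> cells n" by (simp add: cells_def)
  show ?thesis
  proof (rule reduction_number_eq)
    show "cell_offset n (n, 0) < gen5 n 0" by (rule cell_offset_less[OF cell])
    show "level5 n (cell_offset n (n, 0)) = n" by (simp add: level5_cell_offset cell_level_def)
  qed (use n level5_le in auto)
qed

section \<open>The columns of the block matrix\<close>

definition cell_column :: "nat \<Rightarrow> nat \<times> nat \<Rightarrow> nat vec" where
  "cell_column n p = vec (n + 1) (\<lambda>i. max i (case_prod cell_level p) * gen5 n 0 + cell_offset n p)"

text \<open>
  The cells of the columns of the eleven blocks, from left to right, for \<open>n = 2 h\<close>. A product
  \<open>j m\<^sub>k\<close> in the formula of a column contributes \<open>j\<close> times the offset of \<open>m\<^sub>k\<close>, and the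
  coefficients of the generators add up to the level of the cell.
\<close>

definition block_cells :: "nat \<Rightarrow> (nat \<times> nat) list" where
  "block_cells h = concat
    [[(0, 0), (0, 1)],
     map (\<lambda>j. (0, 2 * j)) [1..<h + 1],
     map (\<lambda>j. (j, 0)) [1..<2 * h + 1],
     map (\<lambda>j. (j, j)) [1..<2 * h + 1],
     map (\<lambda>j. (0, 2 * j + 1)) [1..<h + 1],
     map (\<lambda>j. (1, 2 * j)) [1..<h + 1],
     concat (map (\<lambda>s. map (\<lambda>j. (2 * s, 2 * s + 2 * j)) [1..<h - s + 1]) [1..<h]),
     concat (map (\<lambda>s. map (\<lambda>j. (2 * s - 1, 2 * s - 1 + 2 * j)) [1..<h + 1 - s + 1]) [1..<h + 1]),
     concat (map (\<lambda>s. map (\<lambda>j. (2 * h + 1 - s, 2 * h + 1 - s - j)) [1..<2 * h - s + 1]) [1..<2 * h]),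
     concat (map (\<lambda>s. map (\<lambda>j. (2 * s + 1, 2 * s + 2 * j)) [1..<h - s + 1]) [1..<h]),
     concat (map (\<lambda>s. map (\<lambda>j. (2 * s, 2 * s - 1 + 2 * j)) [1..<h + 1 - s + 1]) [1..<h])]"

lemma cols_mat_from1:
  "cols (mat_from1 nr nc f) = map (\<lambda>j. vec nr (\<lambda>i. f (i + 1) j)) [1..<nc + 1]"
  by (rule nth_equalityI) (auto simp: mat_from1_def simp del: upt_Suc)

lemma cols_block_row:
  assumes "\<And>A. A \<in> set As \<Longrightarrow> dim_row A = nr"
  shows "cols (block_row nr As) = concat (map cols As)"
  unfolding block_row_def
proof (rule cols_mat_of_cols)
  show "set (concat (map cols As)) \<subseteq> carrier_vec nr"
  proof
    fix v assume "v \<in> set (concat (map cols As))"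
    then obtain A where "A \<in> set As" "v \<in> set (cols A)" by auto
    then show "v \<in> carrier_vec nr" using cols_dim[of A] assms by auto
  qed
qed

lemma dim_row_mat_from1 [simp]: "dim_row (mat_from1 nr nc f) = nr"
  by (simp add: mat_from1_def)

lemma dim_row_block_row [simp]: "dim_row (block_row nr As) = nr"
  by (simp add: block_row_def)

lemma cols_block:
  assumes "\<And>i j. i \<le> n \<Longrightarrow> 1 \<le> j \<Longrightarrow> j \<le> nc \<Longrightarrow>
    f (i + 1) j = max i (case_prod cell_level (p j)) * gen5 n 0 + cell_offset n (p j)"
  shows "cols (mat_from1 (n + 1) nc f) = map (cell_column n) (map p [1..<nc + 1])"
  unfolding cols_mat_from1 map_map
proof (rule map_cong[OF refl])
  fix j assume "j \<in> set [1..<nc + 1]"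
  then show "vec (n + 1) (\<lambda>i. f (i + 1) j) = (cell_column n \<circ> p) j"
    using assms by (intro eq_vecI) (auto simp: cell_column_def)
qed

lemma cols_block_row_map:
  assumes "\<And>s. s \<in> set ss \<Longrightarrow> dim_row (Q s) = n + 1"
    and "\<And>s. s \<in> set ss \<Longrightarrow> cols (Q s) = map (cell_column n) (ps s)"
  shows "cols (block_row (n + 1) (map Q ss)) = map (cell_column n) (concat (map ps ss))"
proof -
  have "cols (block_row (n + 1) (map Q ss)) = concat (map cols (map Q ss))"
    using assms(1) by (intro cols_block_row) auto
  also have "map cols (map Q ss) = map (map (cell_column n)) (map ps ss)"
    using assms(2) by simp
  finally show ?thesis by (simp only: map_concat)
qed

text \<open>
  The common shape of the entries of all blocks: \<open>base\<close> is the Apery element of level \<open>L\<close> and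
  residue \<open>off\<close>, and the correction \<open>g\<close> of the blocks is the truncated difference \<open>i - L\<close>.
\<close>
lemma entry_eq:
  fixes L N off g base :: nat
  assumes "base = L * N + off" "g = i - L"
  shows "base + g * N = max i L * N + off"
  using assms by (simp add: max_def add_mult_distrib[symmetric])

lemma cols_blocks:
  assumes n: "n = 2 * h"
  shows "cols (B1 n) = map (cell_column n) [(0, 0), (0, 1)]"
    and "cols (B2 n) = map (cell_column n) (map (\<lambda>j. (0, 2 * j)) [1..<h + 1])"
    and "cols (B34 n 3) = map (cell_column n) (map (\<lambda>j. (j, 0)) [1..<2 * h + 1])"
    and "cols (B34 n 4) = map (cell_column n) (map (\<lambda>j. (j, j)) [1..<2 * h + 1])"
    and "cols (B5 n) = map (cell_column n) (map (\<lambda>j. (0, 2 * j + 1)) [1..<h + 1])"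
    and "cols (B6 n) = map (cell_column n) (map (\<lambda>j. (1, 2 * j)) [1..<h + 1])"
    and "1 \<le> s \<Longrightarrow> cols (Q7 n s) = map (cell_column n) (map (\<lambda>j. (2 * s, 2 * s + 2 * j)) [1..<h - s + 1])"
    and "1 \<le> s \<Longrightarrow> cols (Q8 n s) =
      map (cell_column n) (map (\<lambda>j. (2 * s - 1, 2 * s - 1 + 2 * j)) [1..<h + 1 - s + 1])"
    and "1 \<le> s \<Longrightarrow> s < n \<Longrightarrow> cols (Q9 n s) =
      map (cell_column n) (map (\<lambda>j. (2 * h + 1 - s, 2 * h + 1 - s - j)) [1..<2 * h - s + 1])"
    and "1 \<le> s \<Longrightarrow> cols (Q10 n s) = map (cell_column n) (map (\<lambda>j. (2 * s + 1, 2 * s + 2 * j)) [1..<h - s + 1])"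
    and "1 \<le> s \<Longrightarrow> cols (Q11 n s) =
      map (cell_column n) (map (\<lambda>j. (2 * s, 2 * s - 1 + 2 * j)) [1..<h + 1 - s + 1])"
proof -
  have h: "n div 2 = h" using n by simp
  have "gen5 n 0 + (i - Suc 0) * gen5 n 0 = i * gen5 n 0" if "\<not> i \<le> Suc 0" for i
    using that by (cases i) auto
  then show "cols (B1 n) = map (cell_column n) [(0, 0), (0, 1)]"
    unfolding B1_def cols_mat_from1
    by (auto simp: cell_column_def cell_offset_def cell_level_def gen5_simps max_def
        numeral_eq_Suc upt_rec)
  show "cols (B2 n) = map (cell_column n) (map (\<lambda>j. (0, 2 * j)) [1..<h + 1])"
    unfolding B2_def h by (intro cols_block, unfold prod.case, rule entry_eq)
      (auto simp: cell_offset_def cell_level_def gen5_simps algebra_simps)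
  show "cols (B34 n 3) = map (cell_column n) (map (\<lambda>j. (j, 0)) [1..<2 * h + 1])"
    unfolding B34_def n[symmetric] by (intro cols_block, unfold prod.case, rule entry_eq)
      (auto simp: cell_offset_def cell_level_def gen5_simps algebra_simps)
  show "cols (B34 n 4) = map (cell_column n) (map (\<lambda>j. (j, j)) [1..<2 * h + 1])"
    unfolding B34_def n[symmetric] by (intro cols_block, unfold prod.case, rule entry_eq)
      (auto simp: cell_offset_def cell_level_def gen5_simps algebra_simps)
  show "cols (B5 n) = map (cell_column n) (map (\<lambda>j. (0, 2 * j + 1)) [1..<h + 1])"
    unfolding B5_def h by (intro cols_block, unfold prod.case, rule entry_eq)
      (auto simp: cell_offset_def cell_level_def gen5_simps algebra_simps)
  show "cols (B6 n) = map (cell_column n) (map (\<lambda>j. (1, 2 * j)) [1..<h + 1])"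
    unfolding B6_def h by (intro cols_block, unfold prod.case, rule entry_eq)
      (auto simp: cell_offset_def cell_level_def gen5_simps algebra_simps)
  show "cols (Q7 n s) = map (cell_column n) (map (\<lambda>j. (2 * s, 2 * s + 2 * j)) [1..<h - s + 1])"
    if "1 \<le> s"
    unfolding Q7_def h by (intro cols_block, unfold prod.case, rule entry_eq)
      (auto simp: cell_offset_def cell_level_def gen5_simps algebra_simps)
  show "cols (Q10 n s) = map (cell_column n) (map (\<lambda>j. (2 * s + 1, 2 * s + 2 * j)) [1..<h - s + 1])"
    if "1 \<le> s"
    unfolding Q10_def h by (intro cols_block, unfold prod.case, rule entry_eq)
      (auto simp: cell_offset_def cell_level_def gen5_simps algebra_simps)
  show "cols (Q8 n s) =
      map (cell_column n) (map (\<lambda>j. (2 * s - 1, 2 * s - 1 + 2 * j)) [1..<h + 1 - s + 1])"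
    if s: "1 \<le> s"
  proof -
    obtain t where "s = Suc t" using s by (cases s) auto
    then show ?thesis
      unfolding Q8_def h by (intro cols_block, unfold prod.case, intro entry_eq)
        (auto simp: cell_offset_def cell_level_def gen5_simps algebra_simps)
  qed
  show "cols (Q11 n s) =
      map (cell_column n) (map (\<lambda>j. (2 * s, 2 * s - 1 + 2 * j)) [1..<h + 1 - s + 1])"
    if s: "1 \<le> s"
  proof -
    obtain t where "s = Suc t" using s by (cases s) auto
    then show ?thesis
      unfolding Q11_def h by (intro cols_block, unfold prod.case, intro entry_eq)
        (auto simp: cell_offset_def cell_level_def gen5_simps algebra_simps)
  qed
  show "cols (Q9 n s) =
      map (cell_column n) (map (\<lambda>j. (2 * h + 1 - s, 2 * h + 1 - s - j)) [1..<2 * h - s + 1])"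
    if s: "1 \<le> s" "s < n"
    unfolding Q9_def n[symmetric]
  proof (intro cols_block, unfold prod.case, rule entry_eq)
    fix i j assume j: "1 \<le> j" "j \<le> n - s"
    then obtain t where t: "n = s + j + t" using s
      by (metis le_add_diff_inverse less_imp_le le_Suc_ex add.assoc)
    show "(n - s - j + 1) * gen5 n 4 + j * gen5 n 3
      = cell_level (n + 1 - s) (n + 1 - s - j) * gen5 n 0 + cell_offset n (n + 1 - s, n + 1 - s - j)"
      unfolding gen5_simps by (simp add: t cell_offset_def cell_level_def algebra_simps)
    show "(if n + 2 < i + 1 + s then i + 1 + s - n - 2 else 0) = i - cell_level (n + 1 - s) (n + 1 - s - j)"
      using s by (simp add: cell_level_def)
  qed
qed

lemma cols_block_matrix:
  assumes n: "n = 2 * h"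
  shows "cols (block_matrix n) = map (cell_column n) (block_cells h)"
proof -
  have h: "n div 2 = h" using n by simp
  have dims: "dim_row (Q7 n s) = n + 1" "dim_row (Q8 n s) = n + 1" "dim_row (Q9 n s) = n + 1"
    "dim_row (Q10 n s) = n + 1" "dim_row (Q11 n s) = n + 1" for s
    by (simp_all add: Q7_def Q8_def Q9_def Q10_def Q11_def)
  note [simp del] = upt_Suc
  have B7: "cols (B7 n) = map (cell_column n)
      (concat (map (\<lambda>s. map (\<lambda>j. (2 * s, 2 * s + 2 * j)) [1..<h - s + 1]) [1..<h]))"
    unfolding B7_def h by (rule cols_block_row_map) (simp_all only: dims cols_blocks[OF n] set_upt atLeastLessThan_iff)
  have B8: "cols (B8 n) = map (cell_column n)
      (concat (map (\<lambda>s. map (\<lambda>j. (2 * s - 1, 2 * s - 1 + 2 * j)) [1..<h + 1 - s + 1]) [1..<h + 1]))"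
    unfolding B8_def h by (rule cols_block_row_map) (simp_all only: dims cols_blocks[OF n] set_upt atLeastLessThan_iff)
  have B9: "cols (B9 n) = map (cell_column n)
      (concat (map (\<lambda>s. map (\<lambda>j. (2 * h + 1 - s, 2 * h + 1 - s - j)) [1..<2 * h - s + 1]) [1..<2 * h]))"
    unfolding B9_def n[symmetric]
  proof (rule cols_block_row_map)
    fix s assume "s \<in> set [1..<n]"
    then show "cols (Q9 n s) = map (cell_column n) (map (\<lambda>j. (n + 1 - s, n + 1 - s - j)) [1..<n - s + 1])"
      using cols_blocks(9)[OF n, of s] unfolding n[symmetric] by simp
  qed (rule dims)
  have B10: "cols (B10 n) = map (cell_column n)
      (concat (map (\<lambda>s. map (\<lambda>j. (2 * s + 1, 2 * s + 2 * j)) [1..<h - s + 1]) [1..<h]))"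
    unfolding B10_def h by (rule cols_block_row_map) (simp_all only: dims cols_blocks[OF n] set_upt atLeastLessThan_iff)
  have B11: "cols (B11 n) = map (cell_column n)
      (concat (map (\<lambda>s. map (\<lambda>j. (2 * s, 2 * s - 1 + 2 * j)) [1..<h + 1 - s + 1]) [1..<h]))"
    unfolding B11_def h by (rule cols_block_row_map) (simp_all only: dims cols_blocks[OF n] set_upt atLeastLessThan_iff)
  have "cols (block_matrix n) = concat (map cols
      [B1 n, B2 n, B34 n 3, B34 n 4, B5 n, B6 n, B7 n, B8 n, B9 n, B10 n, B11 n])"
    unfolding block_matrix_def
    by (rule cols_block_row)
      (auto simp: B1_def B2_def B34_def B5_def B6_def B7_def B8_def B9_def B10_def B11_def)
  also have "\<dots> = map (cell_column n) (block_cells h)"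
    by (simp only: list.map cols_blocks[OF n] B7 B8 B9 B10 B11 block_cells_def map_concat)
  finally show ?thesis .
qed

text \<open>
  The blocks 1, 2 and 5 cover \<open>c = 0\<close>; for \<open>c > 0\<close>, block 3 covers \<open>r = 0\<close>, block 4 covers \<open>r = c\<close>
  and block 9 the region \<open>0 < r < c\<close>. For \<open>0 < c < r\<close> the parities of \<open>(c, r)\<close> decide: even-even is block 7,
  odd-odd block 8, even-odd block 11 and odd-even block 10, or block 6 if \<open>c = 1\<close>.
\<close>
lemma cells_subset_block_cells: "cells (2 * h) \<subseteq> set (block_cells h)"
proof
  fix p assume "p \<in> cells (2 * h)"
  then obtain c r where p: "p = (c, r)" and c: "c \<le> 2 * h" and r: "r \<le> 2 * h + 1"
    and last: "c = 2 * h \<longrightarrow> r \<le> 2 * h"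
    by (auto simp: cells_def)
  have set_eq: "set (block_cells h) = {(0, 0), (0, 1)}
      \<union> (\<lambda>j. (0, 2 * j)) ` {1..<h + 1}
      \<union> (\<lambda>j. (j, 0)) ` {1..<2 * h + 1}
      \<union> (\<lambda>j. (j, j)) ` {1..<2 * h + 1}
      \<union> (\<lambda>j. (0, 2 * j + 1)) ` {1..<h + 1}
      \<union> (\<lambda>j. (1, 2 * j)) ` {1..<h + 1}
      \<union> (\<Union>s\<in>{1..<h}. (\<lambda>j. (2 * s, 2 * s + 2 * j)) ` {1..<h - s + 1})
      \<union> (\<Union>s\<in>{1..<h + 1}. (\<lambda>j. (2 * s - 1, 2 * s - 1 + 2 * j)) ` {1..<h + 1 - s + 1})
      \<union> (\<Union>s\<in>{1..<2 * h}. (\<lambda>j. (2 * h + 1 - s, 2 * h + 1 - s - j)) ` {1..<2 * h - s + 1})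
      \<union> (\<Union>s\<in>{1..<h}. (\<lambda>j. (2 * s + 1, 2 * s + 2 * j)) ` {1..<h - s + 1})
      \<union> (\<Union>s\<in>{1..<h}. (\<lambda>j. (2 * s, 2 * s - 1 + 2 * j)) ` {1..<h + 1 - s + 1})"
    unfolding block_cells_def
    by (simp only: set_concat set_map set_upt list.set Union_insert Union_empty image_insert
        image_empty image_image Un_empty_right Un_assoc UN_simps)
  have m1: "(0, 0) \<in> set (block_cells h)" "(0, 1) \<in> set (block_cells h)"
    unfolding set_eq by blast+
  have m2: "(0, 2 * j) \<in> set (block_cells h)" if "j \<in> {1..<h + 1}" for j
    unfolding set_eq using that by blast
  have m3: "(j, 0) \<in> set (block_cells h)" if "j \<in> {1..<2 * h + 1}" for j
    unfolding set_eq using that by blast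
  have m4: "(j, j) \<in> set (block_cells h)" if "j \<in> {1..<2 * h + 1}" for j
    unfolding set_eq using that by blast
  have m5: "(0, 2 * j + 1) \<in> set (block_cells h)" if "j \<in> {1..<h + 1}" for j
    unfolding set_eq using that by blast
  have m6: "(1, 2 * j) \<in> set (block_cells h)" if "j \<in> {1..<h + 1}" for j
    unfolding set_eq using that by blast
  have m7: "(2 * s, 2 * s + 2 * j) \<in> set (block_cells h)"
    if "s \<in> {1..<h}" "j \<in> {1..<h - s + 1}" for s j
    unfolding set_eq
    by (rule UnI1, rule UnI1, rule UnI1, rule UnI1, rule UnI2, rule UN_I[OF that(1)], rule image_eqI[OF refl that(2)])
  have m8: "(2 * s - 1, 2 * s - 1 + 2 * j) \<in> set (block_cells h)"
    if "s \<in> {1..<h + 1}" "j \<in> {1..<h + 1 - s + 1}" for s j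
    unfolding set_eq
    by (rule UnI1, rule UnI1, rule UnI1, rule UnI2, rule UN_I[OF that(1)], rule image_eqI[OF refl that(2)])
  have m9: "(2 * h + 1 - s, 2 * h + 1 - s - j) \<in> set (block_cells h)"
    if "s \<in> {1..<2 * h}" "j \<in> {1..<2 * h - s + 1}" for s j
    unfolding set_eq
    by (rule UnI1, rule UnI1, rule UnI2, rule UN_I[OF that(1)], rule image_eqI[OF refl that(2)])
  have m10: "(2 * s + 1, 2 * s + 2 * j) \<in> set (block_cells h)"
    if "s \<in> {1..<h}" "j \<in> {1..<h - s + 1}" for s j
    unfolding set_eq
    by (rule UnI1, rule UnI2, rule UN_I[OF that(1)], rule image_eqI[OF refl that(2)])
  have m11: "(2 * s, 2 * s - 1 + 2 * j) \<in> set (block_cells h)"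
    if "s \<in> {1..<h}" "j \<in> {1..<h + 1 - s + 1}" for s j
    unfolding set_eq
    by (rule UnI2, rule UN_I[OF that(1)], rule image_eqI[OF refl that(2)])
  consider (column0) "c = 0" | (diagonal) "c \<noteq> 0" "r = 0 \<or> r = c" | (below) "c \<noteq> 0" "0 < r" "r < c"
    | (above) "c \<noteq> 0" "c < r" by linarith
  then show "p \<in> set (block_cells h)"
  proof cases
    case column0
    show ?thesis
    proof (cases "r \<le> 1")
      case True
      then have "r = 0 \<or> r = 1" by auto
      then show ?thesis using m1 column0 p by auto
    next
      case False
      have "r = 2 * (r div 2) \<or> r = 2 * (r div 2) + 1" by presburger
      moreover have "r div 2 \<in> {1..<h + 1}" using False r by auto
      ultimately show ?thesis using m2 m5 column0 p by metis
    qed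
  next
    case diagonal
    then show ?thesis using m3[of c] m4[of c] c p by auto
  next
    case below
    then have "2 * h + 1 - c \<in> {1..<2 * h}" "c - r \<in> {1..<2 * h - (2 * h + 1 - c) + 1}"
      "2 * h + 1 - (2 * h + 1 - c) = c" "c - (c - r) = r"
      using c by auto
    then show ?thesis using m9[of "2 * h + 1 - c" "c - r"] p by metis
  next
    case above
    define a b where "a = c div 2" and "b = r div 2"
    have "c = 2 * a \<or> c = 2 * a + 1" "r = 2 * b \<or> r = 2 * b + 1"
      unfolding a_def b_def by presburger+
    then consider "c = 2 * a" "r = 2 * b" | "c = 2 * a" "r = 2 * b + 1"
      | "c = 2 * a + 1" "r = 2 * b" | "c = 2 * a + 1" "r = 2 * b + 1"
      by blast
    moreover have "a \<le> b" using above by (simp add: a_def b_def div_le_mono)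
    then obtain d where d: "b = a + d" using le_Suc_ex by blast
    ultimately show ?thesis
    proof cases
      case 1
      have "a \<in> {1..<h}" "d \<in> {1..<h - a + 1}" using 1 d above r by auto
      from m7[OF this] show ?thesis using 1 d p by (simp add: algebra_simps)
    next
      case 2
      have "a \<in> {1..<h}" "d + 1 \<in> {1..<h + 1 - a + 1}" using 2 d above c r last by auto
      moreover have "2 * a - 1 + 2 * (d + 1) = r" using 2 d above by simp
      ultimately show ?thesis using m11[of a "d + 1"] 2 p by simp
    next
      case 3
      show ?thesis
      proof (cases "a = 0")
        case True
        then have "b \<in> {1..<h + 1}" using 3 above r by auto
        from m6[OF this] show ?thesis using 3 p True by simp
      next
        case False
        then have "a \<in> {1..<h}" "d \<in> {1..<h - a + 1}" using 3 d above c r by auto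
        from m10[OF this] show ?thesis using 3 d p by (simp add: algebra_simps)
      qed
    next
      case 4
      have "a + 1 \<in> {1..<h + 1}" "d \<in> {1..<h + 1 - (a + 1) + 1}" using 4 d above c r by auto
      from m8[OF this] show ?thesis using 4 d p by (simp add: algebra_simps)
    qed
  qed
qed

lemma length_block_cells:
  assumes "1 \<le> h"
  shows "length (block_cells h) = gen5 (2 * h) 0"
proof -
  obtain g where g: "h = Suc g" using assms by (cases h) auto
  have sum: "2 * (\<Sum>s = 1..<Suc k. m - s) + k * (k + 1) = 2 * k * m" if "k \<le> m" for k m :: nat
    using that
  proof (induction k)
    case (Suc k)
    then obtain d where "m = Suc k + d" using le_Suc_ex by blast
    then show ?case using Suc by (simp add: algebra_simps)
  qed simp
  have "2 * (\<Sum>s = 1..<Suc g. h - s) = g * g + g"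
    "2 * (\<Sum>s = 1..<Suc (Suc g). h + 1 - s) = g * g + 3 * g + 2"
    "2 * (\<Sum>s = 1..<Suc (Suc (2 * g)). 2 * h - s) = 4 * (g * g) + 6 * g + 2"
    "2 * (\<Sum>s = 1..<Suc g. h + 1 - s) = g * g + 3 * g"
    using sum[of g h] sum[of "Suc g" "h + 1"] sum[of "Suc (2 * g)" "2 * h"] sum[of g "h + 1"]
    unfolding g by (simp_all add: algebra_simps del: sum.op_ivl_Suc)
  moreover have "length (block_cells h) = 2 + 7 * h
      + (\<Sum>s = 1..<Suc g. h - s) + (\<Sum>s = 1..<Suc (Suc g). h + 1 - s)
      + (\<Sum>s = 1..<Suc (Suc (2 * g)). 2 * h - s) + (\<Sum>s = 1..<Suc g. h - s)
      + (\<Sum>s = 1..<Suc g. h + 1 - s)"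
    by (simp add: block_cells_def length_concat o_def interv_sum_list_conv_sum_set_nat g
        del: upt_Suc sum.op_ivl_Suc)
  moreover have "gen5 (2 * h) 0 = 4 * (g * g) + 14 * g + 11"
    by (simp add: gen5_0 g algebra_simps)
  ultimately show ?thesis using g by linarith
qed

text \<open>
  Since the list has as many entries as there are cells and contains each of them, it has no
  repetitions and no further entries.
\<close>
lemma block_cells_bij:
  assumes "1 \<le> h"
  shows "bij_betw (\<lambda>i. block_cells h ! i) {..<gen5 (2 * h) 0} (cells (2 * h))"
proof -
  have card: "card (cells (2 * h)) = gen5 (2 * h) 0"
    using bij_betw_same_card[OF cell_offset_bij] by simp
  have "card (set (block_cells h)) \<le> card (cells (2 * h))"
    using card_length[of "block_cells h"] by (simp add: card length_block_cells[OF assms])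
  then have set: "set (block_cells h) = cells (2 * h)"
    by (intro card_seteq[symmetric] finite_set cells_subset_block_cells)
  then have "distinct (block_cells h)"
    by (intro card_distinct) (simp add: card length_block_cells[OF assms])
  then show ?thesis
    by (rule bij_betw_nth) (simp_all add: set length_block_cells[OF assms])
qed

theorem theorem5p13:
  fixes n :: nat and \<omega> :: "nat \<Rightarrow> nat"
  assumes "n \<ge> 8" and "even n"
    and first_row: "\<forall>j < gen5 n 0. \<omega> j = block_matrix n $$ (0, j)"
  shows "numerical_semigroup (semigroup5 n) \<and>
    semigroup_multiplicity (semigroup5 n) = gen5 n 0 \<and>
    apery_indexing (semigroup5 n) (gen5 n 0) \<omega> \<and>
    apery_table (semigroup5 n) (gen5 n 0) \<omega> \<in> carrier_mat (n + 1) (gen5 n 0) \<and>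
    apery_table (semigroup5 n) (gen5 n 0) \<omega> = block_matrix n"
proof -
  obtain h where h: "n = 2 * h" using \<open>even n\<close> by (elim evenE)
  have n1: "1 \<le> n" and h1: "1 \<le> h" using \<open>n \<ge> 8\<close> h by auto
  interpret leveled_semigroup "semigroup5 n" "gen5 n 0" "level5 n"
    by (rule leveled_semigroup5[OF n1])
  define N where "N = gen5 n 0"
  define e where "e = cell_offset n \<circ> (\<lambda>i. block_cells h ! i)"
  have e_bij: "bij_betw e {..<N} {..<N}"
    unfolding e_def N_def
    using block_cells_bij[OF h1] cell_offset_bij[of n] by (intro bij_betw_trans) (simp_all add: h)
  have e_less: "e i < N" if "i < N" for i
    using bij_betwE[OF e_bij] that by auto
  have e0: "e 0 = 0" by (simp add: e_def block_cells_def cell_offset_def)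
  have e_0_iff: "e i = 0 \<longleftrightarrow> i = 0" if "i < N" for i
    using bij_betw_imp_inj_on[OF e_bij] e0 that by (metis gr_zeroI inj_onD lessThan_iff not_less0)
  have dims: "dim_row (block_matrix n) = n + 1" "dim_col (block_matrix n) = N"
    using arg_cong[OF cols_block_matrix[OF h], of length] length_block_cells[OF h1]
    by (simp_all add: block_matrix_def N_def h)
  have entry: "block_matrix n $$ (i, j) = max i (level5 n (e j)) * N + e j"
    if "i < n + 1" "j < N" for i j
  proof -
    obtain c r where cell: "block_cells h ! j = (c, r)" by fastforce
    moreover have "block_cells h ! j \<in> cells n"
      using bij_betwE[OF block_cells_bij[OF h1]] that(2) unfolding N_def h by blast
    ultimately have "(c, r) \<in> cells n" by simp
    then have level: "level5 n (e j) = cell_level c r"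
      unfolding e_def using cell by (simp add: cells_def level5_cell_offset)
    have "block_matrix n $$ (i, j) = cols (block_matrix n) ! j $ i"
      using that dims by simp
    also have "\<dots> = cell_column n (c, r) $ i"
      using cols_block_matrix[OF h] length_block_cells[OF h1] that(2) cell by (simp add: N_def h)
    also have "\<dots> = max i (level5 n (e j)) * N + e j"
      using that(1) level cell by (simp add: cell_column_def e_def N_def)
    finally show ?thesis .
  qed
  have \<omega>: "\<omega> i = level5 n (e i) * N + e i" if "i < N" for i
    using first_row entry[of 0 i] that by (simp add: N_def)
  have table: "apery_table (semigroup5 n) (gen5 n 0) \<omega>
      = mat (n + 1) N (\<lambda>(s, i). apery_entry (semigroup5 n) N \<omega> s i)"
    by (simp only: apery_table_def reduction_number_semigroup5[OF n1] N_def)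
  have table_eq: "apery_table (semigroup5 n) (gen5 n 0) \<omega> = block_matrix n"
    unfolding table
  proof (rule eq_matI)
    fix s i assume "s < dim_row (block_matrix n)" "i < dim_col (block_matrix n)"
    then have si: "s < n + 1" "i < N" by (simp_all add: dims)
    have "apery_entry (semigroup5 n) N \<omega> s i = max s (level5 n (e i)) * N + e i"
      unfolding N_def using \<omega> e_less e_0_iff si(2) by (intro apery_entry_eq) (simp_all add: N_def)
    then show "mat (n + 1) N (\<lambda>(s, i). apery_entry (semigroup5 n) N \<omega> s i) $$ (s, i)
        = block_matrix n $$ (s, i)"
      using si entry[OF si] by simp
  qed (simp_all add: dims)
  have indexing: "apery_indexing (semigroup5 n) (gen5 n 0) \<omega>"
    unfolding apery_indexing_def
  proof
    have "inj_on (\<lambda>t. level5 n t * N + t) {..<N}"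
      by (rule inj_on_inverseI[where g = "\<lambda>x. x mod N"]) simp
    then have "bij_betw (\<lambda>t. level5 n t * N + t) {..<N} (apery_set (semigroup5 n) N)"
      unfolding bij_betw_def by (simp add: apery_set_eq N_def)
    from bij_betw_trans[OF e_bij this]
    show "bij_betw \<omega> {..<gen5 n 0} (apery_set (semigroup5 n) (gen5 n 0))"
      unfolding N_def[symmetric] by (rule bij_betw_cong[THEN iffD1, rotated]) (simp add: \<omega>)
    show "\<omega> 0 = 0" using \<omega>[of 0] e0 a_pos level5_0_iff by (simp add: N_def)
  qed
  have carrier: "block_matrix n \<in> carrier_mat (n + 1) (gen5 n 0)"
    using dims unfolding N_def by (rule carrier_matI)
  show ?thesis
    unfolding table_eq
    by (intro conjI numerical_semigroup5[OF n1] multiplicity indexing carrier refl)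
qed

end
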